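(* Let $A$ be a finite-dimensional commutative algebra over a field $\mathbb{F}$. For any evolution $\mathbb{F}$-algebra $E$ with an algebra monomorphism $\Phi\colon A\hookrightarrow E$ such that $E^2\subseteq\Phi(A)$, the following hold: (1) For $k\geq 2$, $\Phi(A^{(k)})\subseteq E^{(k)}\subseteq \Phi(A^{(k-1)})$ and $\dim A^{(k)}\leq \dim E^{(k)}\leq \dim A^{(k-1)}$. (2) If $A$ is perfect (i.e. $A^2=A$), then $A\cong E^2$. (3) The algebra $A$ is solvable if and only if $E$ is solvable. (4) The map $\Phi$ induces a bijection between the sets of idempotents of $A$ and of $E$.
   Context: An algebra over a field $\mathbb{F}$ is an $\mathbb{F}$-vector space with a bilinear multiplication, not assumed associative or unital. Algebra morphisms are linear multiplicative maps (not required to preserve a unit). An algebra $E$ over $\mathbb{F}$ is an evolution algebra if it admits a basis $\{e_i : i\in I\}$, called a natural basis, such that $e_ie_j=0$ whenever $i\neq j$. For subspaces $U,V$ of an algebra, $UV$ denotes the linear span of the products $uv$ with $u\in U$, $v\in V$, and $A^2=AA$. The derived series of an algebra $A$ is $A^{(1)}=A$, $A^{(k+1)}=A^{(k)}A^{(k)}$ for $k\geq 1$; $A$ is solvable if $A^{(k)}=0$ for some $k$. An idempotent is an element $e$ with $e^2=e$. *)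

theory Defs
  imports Complex_Main
begin

text \<open>
  Algebras live on whole types: the additive group is the type-class structure, while the scalar
  action and the multiplication are parameters, so that \<open>'f\<close> is an arbitrary field and neither
  associativity nor a unit is built in.
\<close>

locale nonassoc_algebra = vector_space scale
  for scale :: "'f::field \<Rightarrow> 'a::ab_group_add \<Rightarrow> 'a" (infixr "*s" 75) +
  fixes mult :: "'a \<Rightarrow> 'a \<Rightarrow> 'a" (infixl "\<cdot>" 70)
  assumes linear_mult_left: "\<And>y. Vector_Spaces.linear scale scale (\<lambda>x. x \<cdot> y)"
    and linear_mult_right: "\<And>x. Vector_Spaces.linear scale scale (\<lambda>y. x \<cdot> y)"
begin

definition set_product :: "'a set \<Rightarrow> 'a set \<Rightarrow> 'a set" where
  "set_product U V = span {u \<cdot> v | u v. u \<in> U \<and> v \<in> V}"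

definition square :: "'a set" where
  "square = set_product UNIV UNIV"

definition perfect :: bool where
  "perfect \<longleftrightarrow> square = UNIV"

text \<open>The series is indexed from 1; the value at 0 is a dummy equal to the value at 1.\<close>

fun derived_series :: "nat \<Rightarrow> 'a set" where
  "derived_series 0 = UNIV"
| "derived_series (Suc 0) = UNIV"
| "derived_series (Suc (Suc k)) =
     set_product (derived_series (Suc k)) (derived_series (Suc k))"

definition solvable :: bool where
  "solvable \<longleftrightarrow> (\<exists>k\<ge>1. derived_series k = {0})"

definition idempotents :: "'a set" where
  "idempotents = {e. e \<cdot> e = e}"

definition natural_basis :: "'a set \<Rightarrow> bool" where
  "natural_basis B \<longleftrightarrow> independent B \<and> span B = UNIV \<and>
     (\<forall>x\<in>B. \<forall>y\<in>B. x \<noteq> y \<longrightarrow> x \<cdot> y = 0)"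

end

locale commutative_algebra = nonassoc_algebra +
  assumes mult_commute: "x \<cdot> y = y \<cdot> x"

locale evolution_algebra = nonassoc_algebra +
  assumes ex_natural_basis: "\<exists>B. natural_basis B"

locale algebra_hom =
  dom: nonassoc_algebra scaleA multA + cod: nonassoc_algebra scaleE multE +
  Vector_Spaces.linear scaleA scaleE f
  for scaleA :: "'f::field \<Rightarrow> 'a::ab_group_add \<Rightarrow> 'a"
    and multA :: "'a \<Rightarrow> 'a \<Rightarrow> 'a"
    and scaleE :: "'f \<Rightarrow> 'e::ab_group_add \<Rightarrow> 'e"
    and multE :: "'e \<Rightarrow> 'e \<Rightarrow> 'e"
    and f :: "'a \<Rightarrow> 'e" +
  assumes map_mult: "f (multA x y) = multE (f x) (f y)"

locale algebra_mono = algebra_hom +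
  assumes inj_map: "inj f"

text \<open>
  Isomorphism of the subalgebras with carriers \<open>S\<close> and \<open>T\<close>; the values of the isomorphism
  outside \<open>S\<close> are irrelevant.
\<close>

definition subalgebras_isomorphic ::
  "('f::field \<Rightarrow> 'a::ab_group_add \<Rightarrow> 'a) \<Rightarrow> ('a \<Rightarrow> 'a \<Rightarrow> 'a) \<Rightarrow> 'a set \<Rightarrow>
   ('f \<Rightarrow> 'e::ab_group_add \<Rightarrow> 'e) \<Rightarrow> ('e \<Rightarrow> 'e \<Rightarrow> 'e) \<Rightarrow> 'e set \<Rightarrow> bool" where
  "subalgebras_isomorphic scaleA multA S scaleE multE T \<longleftrightarrow>
     (\<exists>f. bij_betw f S T \<and>
        (\<forall>x\<in>S. \<forall>y\<in>S. f (x + y) = f x + f y) \<and>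
        (\<forall>c. \<forall>x\<in>S. f (scaleA c x) = scaleE c (f x)) \<and>
        (\<forall>x\<in>S. \<forall>y\<in>S. f (multA x y) = multE (f x) (f y)))"

end

theory Submission
  imports Defs
begin

text \<open>
  Since \<open>\<Phi>(AA) = \<Phi>(A)\<Phi>(A)\<close>, squaring the inclusions \<open>\<Phi>(A\<^sup>2) \<subseteq> E\<^sup>2 \<subseteq> \<Phi>(A)\<close> repeatedly interleaves
  the two derived series. An idempotent \<open>e = ee\<close> of \<open>E\<close> lies in \<open>E\<^sup>2\<close>, hence in \<open>\<Phi>(A)\<close>.
\<close>

text \<open>\<open>dim\<close> takes the value 0 on spaces without a finite basis, so monotonicity
  can fail there. The finite set \<open>S\<close> rules this out: an independent subset of
  \<open>span S\<close> is finite, and the basis of \<open>W\<close> then bounds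
  \<open>dim V\<close>.\<close>

lemma (in vector_space) dim_mono_finite_span:
  assumes "V \<subseteq> W" and "W \<subseteq> span S" and "finite S"
  shows "dim V \<le> dim W"
proof -
  obtain B where B: "B \<subseteq> W" "independent B" "W \<subseteq> span B" "card B = dim W"
    by (rule basis_exists)
  have "finite B"
    using independent_span_bound[of S B] B assms by blast
  then have "dim V \<le> card B"
    using B(3) assms(1) by (intro dim_le_card) auto
  with B(4) show ?thesis by simp
qed

text \<open>Injectivity keeps the image of a basis independent and of the same cardinality; if the
  basis is infinite, both cards are 0.\<close>

lemma (in Vector_Spaces.linear) dim_image_eq_if_inj:
  assumes "inj f"
  shows "vs2.dim (f ` S) = vs1.dim S"
proof -
  obtain B where B: "B \<subseteq> S" "vs1.independent B" "S \<subseteq> vs1.span B" "card B = vs1.dim S"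
    by (rule vs1.basis_exists)
  have "vs2.dim (f ` S) = card (f ` B)"
  proof (rule vs2.dim_unique)
    show "f ` S \<subseteq> vs2.span (f ` B)"
      using B(3) by (auto simp: span_image)
    show "vs2.independent (f ` B)"
      using B(2) assms by (intro independent_injective_image) (auto intro: inj_on_subset)
  qed (use B(1) in auto)
  also have "\<dots> = card B"
    using assms by (intro card_image) (auto intro: inj_on_subset)
  finally show ?thesis using B(4) by simp
qed

context nonassoc_algebra
begin

lemma set_product_mono: "U \<subseteq> U' \<Longrightarrow> V \<subseteq> V' \<Longrightarrow> set_product U V \<subseteq> set_product U' V'"
  unfolding set_product_def by (intro span_mono) blast

lemma derived_series_Suc:
  "k \<ge> 1 \<Longrightarrow> derived_series (Suc k) = set_product (derived_series k) (derived_series k)"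
  by (cases k) auto

lemma derived_series_2: "derived_series 2 = square"
  by (simp add: numeral_2_eq_2 square_def)

lemma zero_in_derived_series: "0 \<in> derived_series k"
  by (induction k rule: derived_series.induct) (auto simp: set_product_def span_zero)

text \<open>Comparing the two series yields inclusions only; this turns them into
  solvability.\<close>

lemma derived_series_eq_zero_iff: "derived_series k = {0} \<longleftrightarrow> derived_series k \<subseteq> {0}"
  using zero_in_derived_series by blast

lemma idempotents_subset_square: "idempotents \<subseteq> square"
proof
  fix e assume "e \<in> idempotents"
  then have "e = e \<cdot> e" by (simp add: idempotents_def)
  then show "e \<in> square"
    unfolding square_def set_product_def by (intro span_base) blast
qed

end

context algebra_hom
begin

text \<open>\<open>f\<close> carries generating products to generating products, and a linear map
  commutes with \<open>span\<close>.\<close>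

lemma image_set_product: "f ` dom.set_product U V = cod.set_product (f ` U) (f ` V)"
proof -
  have "f ` {multA u v | u v. u \<in> U \<and> v \<in> V} = {multE u v | u v. u \<in> f ` U \<and> v \<in> f ` V}"
    by (force simp: map_mult)
  then show ?thesis
    unfolding dom.set_product_def cod.set_product_def by (simp flip: span_image)
qed

lemma image_derived_series_subset: "f ` dom.derived_series k \<subseteq> cod.derived_series k"
  by (induction k rule: dom.derived_series.induct)
    (auto simp: image_set_product cod.set_product_mono simp del: image_subset_iff)

text \<open>The hypothesis on the square is the case \<open>k = 1\<close>; squaring both sides of an
  inclusion gives the next one.\<close>

lemma derived_series_subset_image:
  assumes "cod.square \<subseteq> range f" and "k \<ge> 1"
  shows "cod.derived_series (Suc k) \<subseteq> f ` dom.derived_series k"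
  using \<open>k \<ge> 1\<close>
proof (induction k rule: nat_induct_at_least)
  case base
  then show ?case using assms(1) by (simp add: cod.square_def)
next
  case (Suc k)
  then show ?case
    \<comment> \<open>The instance at \<open>Suc k\<close> unfolds one layer only, so
      \<open>cod.derived_series (Suc k)\<close> stays in the form of the induction
      hypothesis.\<close>
    by (simp add: cod.derived_series_Suc[of "Suc k"] dom.derived_series_Suc image_set_product
        cod.set_product_mono del: cod.derived_series.simps)
qed

end

context algebra_mono
begin

lemma solvable_iff:
  assumes "cod.square \<subseteq> range f"
  shows "dom.solvable \<longleftrightarrow> cod.solvable"
proof
  assume "dom.solvable"
  then obtain k where k: "k \<ge> 1" "dom.derived_series k = {0}"
    by (auto simp: dom.solvable_def)
  \<comment> \<open>The series of the codomain may vanish one index later.\<close>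
  then have "cod.derived_series (Suc k) \<subseteq> {0}"
    using derived_series_subset_image[OF assms, of k] by (simp add: zero)
  then show "cod.solvable"
    unfolding cod.solvable_def cod.derived_series_eq_zero_iff by (intro exI[of _ "Suc k"]) simp
next
  assume "cod.solvable"
  then obtain k where k: "k \<ge> 1" "cod.derived_series k = {0}"
    by (auto simp: cod.solvable_def)
  \<comment> \<open>Writing 0 as \<open>f 0\<close> lets injectivity cancel
    \<open>f\<close>.\<close>
  then have "f ` dom.derived_series k \<subseteq> f ` {0}"
    using image_derived_series_subset[of k] by (simp add: zero)
  then have "dom.derived_series k \<subseteq> {0}"
    using inj_map by (simp only: inj_image_subset_iff)
  with k(1) show "dom.solvable"
    unfolding dom.solvable_def dom.derived_series_eq_zero_iff by blast
qed

lemma bij_betw_idempotents: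
  assumes "cod.square \<subseteq> range f"
  shows "bij_betw f dom.idempotents cod.idempotents"
proof -
  \<comment> \<open>The square of \<open>f a\<close> is the image of the square of \<open>a\<close>,
    so injectivity reflects idempotency.\<close>
  have "f a \<in> cod.idempotents \<longleftrightarrow> a \<in> dom.idempotents" for a
    using inj_map by (simp add: dom.idempotents_def cod.idempotents_def inj_eq flip: map_mult)
  moreover have "cod.idempotents \<subseteq> range f"
    using cod.idempotents_subset_square assms by blast
  ultimately have "f ` dom.idempotents = cod.idempotents" by blast
  with inj_map show ?thesis by (auto simp: bij_betw_def intro: inj_on_subset)
qed

lemma perfect_isomorphic_square:
  assumes "cod.square \<subseteq> range f" and "dom.perfect"
  shows "subalgebras_isomorphic scaleA multA UNIV scaleE multE cod.square"
proof -
  \<comment> \<open>By perfectness the second term of the derived series of the domain is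
    everything, so \<open>f\<close> itself is the isomorphism.\<close>
  have "range f \<subseteq> cod.square"
    using image_derived_series_subset[of 2] assms(2)
    by (simp add: dom.derived_series_2 cod.derived_series_2 dom.perfect_def)
  with assms(1) have "bij_betw f UNIV cod.square"
    using inj_map by (auto simp: bij_betw_def)
  then show ?thesis
    unfolding subalgebras_isomorphic_def
    by (intro exI[of _ f]) (simp add: add scale map_mult)
qed

end

theorem proposition3p8:
  fixes scaleA :: "'f::field \<Rightarrow> 'a::ab_group_add \<Rightarrow> 'a"
    and multA :: "'a \<Rightarrow> 'a \<Rightarrow> 'a"
    and scaleE :: "'f \<Rightarrow> 'e::ab_group_add \<Rightarrow> 'e"
    and multE :: "'e \<Rightarrow> 'e \<Rightarrow> 'e"
    and \<Phi> :: "'a \<Rightarrow> 'e"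
  assumes "commutative_algebra scaleA multA"
    and "\<exists>B. finite_dimensional_vector_space scaleA B"
    and "evolution_algebra scaleE multE"
    and "algebra_mono scaleA multA scaleE multE \<Phi>"
    and "nonassoc_algebra.square scaleE multE \<subseteq> range \<Phi>"
  shows "(\<forall>k\<ge>2.
            \<Phi> ` nonassoc_algebra.derived_series scaleA multA k
              \<subseteq> nonassoc_algebra.derived_series scaleE multE k \<and>
            nonassoc_algebra.derived_series scaleE multE k
              \<subseteq> \<Phi> ` nonassoc_algebra.derived_series scaleA multA (k - 1) \<and>
            vector_space.dim scaleA (nonassoc_algebra.derived_series scaleA multA k)
              \<le> vector_space.dim scaleE (nonassoc_algebra.derived_series scaleE multE k) \<and>
            vector_space.dim scaleE (nonassoc_algebra.derived_series scaleE multE k)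
              \<le> vector_space.dim scaleA (nonassoc_algebra.derived_series scaleA multA (k - 1))) \<and>
         (nonassoc_algebra.perfect scaleA multA \<longrightarrow>
            subalgebras_isomorphic scaleA multA UNIV
              scaleE multE (nonassoc_algebra.square scaleE multE)) \<and>
         (nonassoc_algebra.solvable scaleA multA \<longleftrightarrow> nonassoc_algebra.solvable scaleE multE) \<and>
         bij_betw \<Phi> (nonassoc_algebra.idempotents multA) (nonassoc_algebra.idempotents multE)"
proof -
  interpret algebra_mono scaleA multA scaleE multE \<Phi> by fact
  obtain B where "finite_dimensional_vector_space scaleA B" using assms(2) by blast
  then interpret A: finite_dimensional_vector_space scaleA B .
  note sq = assms(5)
  \<comment> \<open>E may be infinite-dimensional; the image of a finite basis of A provides the
    finite spanning set for the dimension comparisons.\<close>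
  have fin: "\<Phi> ` S \<subseteq> cod.span (\<Phi> ` B)" for S
    by (simp add: span_image A.span_Basis image_mono)
  have fin_B: "finite (\<Phi> ` B)" using A.finite_Basis by simp
  have "\<Phi> ` dom.derived_series k \<subseteq> cod.derived_series k \<and>
      cod.derived_series k \<subseteq> \<Phi> ` dom.derived_series (k - 1) \<and>
      dom.dim (dom.derived_series k) \<le> cod.dim (cod.derived_series k) \<and>
      cod.dim (cod.derived_series k) \<le> dom.dim (dom.derived_series (k - 1))"
    if "k \<ge> 2" for k
  proof -
    have lower: "\<Phi> ` dom.derived_series k \<subseteq> cod.derived_series k"
      by (rule image_derived_series_subset)
    have upper: "cod.derived_series k \<subseteq> \<Phi> ` dom.derived_series (k - 1)"
      \<comment> \<open>\<open>k \<ge> 2\<close> ensures \<open>k - 1 \<ge> 1\<close>, where the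
        indexing of the series starts.\<close>
      using derived_series_subset_image[OF sq, of "k - 1"] that by simp
    have "cod.dim (\<Phi> ` dom.derived_series k) \<le> cod.dim (cod.derived_series k)"
      \<comment> \<open>Here the larger space is a term of the series of E, confined to a finite
        span by the upper inclusion.\<close>
      using lower order_trans[OF upper fin] fin_B by (rule cod.dim_mono_finite_span)
    moreover have "cod.dim (cod.derived_series k) \<le> cod.dim (\<Phi> ` dom.derived_series (k - 1))"
      using upper fin fin_B by (rule cod.dim_mono_finite_span)
    ultimately show ?thesis
      using lower upper by (simp only: dim_image_eq_if_inj[OF inj_map])
  qed
  then show ?thesis
    using perfect_isomorphic_square[OF sq] solvable_iff[OF sq] bij_betw_idempotents[OF sq]
    by blast
qed

end
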